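(* Let $\mathcal H$ be a real Hilbert space, let $\mu\in\,]0,\infty[$, let $n\ge 1$ be an integer, $I=\{1,\dots,n\}$, and let $\lambda_i>0$ ($i\in I$) satisfy $\sum_{i\in I}\lambda_i=1$. Suppose that for each $i\in I$, $\epsilon_i\ge 0$ is a real number and $f_i:\mathcal H\to\,]-\infty,+\infty]$ is proper, lower semicontinuous and $\epsilon_i$-smooth. Write $\mathbf f=(f_1,\dots,f_n)$, $\boldsymbol\lambda=(\lambda_1,\dots,\lambda_n)$. Then the proximal average $p_\mu(\mathbf f,\boldsymbol\lambda)$ is $\epsilon$-smooth, where $$\epsilon=r_{\mu^{-1}}(\boldsymbol\epsilon,\boldsymbol\lambda)=\Big[\sum_{i\in I}\lambda_i(\epsilon_i+\mu)^{-1}\Big]^{-1}-\mu.$$ In particular, if there exists $i_0\in I$ such that $f_{i_0}$ is $\epsilon_{i_0}$-strongly smooth, then $p_\mu(\mathbf f,\boldsymbol\lambda)$ is $\epsilon$-strongly smooth.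
   Context: For $\epsilon>0$, a proper and convex function $f:\mathcal H\to\,]-\infty,+\infty]$ is $\epsilon$-smooth if for all $x,y\in\mathcal H$ and every $\lambda\in\,]0,1[$ with $(1-\lambda)x+\lambda y\in\operatorname{dom}f=\{f<\infty\}$, $$f\big((1-\lambda)x+\lambda y\big)+\lambda(1-\lambda)\tfrac{1}{2\epsilon}\|x-y\|^2\ge(1-\lambda)f(x)+\lambda f(y).$$ A $0$-smooth function is any proper and convex function (convention $0^{-1}=\infty$, $0\cdot\infty=0$). $f$ is $\epsilon$-strongly smooth if it is $\epsilon$-smooth and $\epsilon>0$. The $\boldsymbol\lambda$-weighted proximal average of $\mathbf f$ with parameter $\mu$ is the function $$p_\mu(\mathbf f,\boldsymbol\lambda)(x)=\frac1\mu\Big(-\frac12\|x\|^2+\inf_{\sum_{i\in I}x_i=x}\sum_{i\in I}\lambda_i\big(\mu f_i(x_i/\lambda_i)+\tfrac12\|x_i/\lambda_i\|^2\big)\Big),\quad x\in\mathcal H.$$ *)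

theory Defs
  imports "HOL-Analysis.Analysis"
begin

text \<open>
  Functions from a real Hilbert space into \<open>]-\<infinity>, +\<infinity>]\<close> are modelled as
  \<open>ereal\<close>-valued functions; the exclusion of the value \<open>-\<infinity>\<close> is part of properness.
\<close>

definition proper_fun :: "('a \<Rightarrow> ereal) \<Rightarrow> bool" where
  "proper_fun f \<longleftrightarrow> (\<forall>x. f x \<noteq> -\<infinity>) \<and> (\<exists>x. f x < \<infinity>)"

definition convex_fun :: "('a::real_vector \<Rightarrow> ereal) \<Rightarrow> bool" where
  "convex_fun f \<longleftrightarrow>
     (\<forall>x y. \<forall>t\<in>{0<..<1::real}.
        f ((1 - t) *\<^sub>R x + t *\<^sub>R y) \<le> ereal (1 - t) * f x + ereal t * f y)"

definition lsc_fun :: "('a::topological_space \<Rightarrow> ereal) \<Rightarrow> bool" where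
  "lsc_fun f \<longleftrightarrow> (\<forall>x. f x \<le> Liminf (at x) f)"

text \<open>
  For \<open>\<epsilon> = 0\<close> the convention \<open>1 / 0 = \<infinity>\<close> makes the inequality vacuous (for \<open>x = y\<close>,
  where \<open>0 * \<infinity> = 0\<close>, it is trivially an equality), so that exactly the
  proper convex functions are \<open>0\<close>-smooth; since \<open>1 / 0 = 0\<close> in HOL this is the guard \<open>\<epsilon> > 0\<close>.
\<close>

definition smooth_fun :: "real \<Rightarrow> ('a::real_normed_vector \<Rightarrow> ereal) \<Rightarrow> bool" where
  "smooth_fun \<epsilon> f \<longleftrightarrow> \<epsilon> \<ge> 0 \<and> proper_fun f \<and> convex_fun f \<and>
     (\<epsilon> > 0 \<longrightarrow>
       (\<forall>x y. \<forall>t\<in>{0<..<1::real}. f ((1 - t) *\<^sub>R x + t *\<^sub>R y) < \<infinity> \<longrightarrow>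
          f ((1 - t) *\<^sub>R x + t *\<^sub>R y) + ereal (t * (1 - t) * (1 / (2 * \<epsilon>)) * (norm (x - y))\<^sup>2)
            \<ge> ereal (1 - t) * f x + ereal t * f y))"

definition strongly_smooth_fun :: "real \<Rightarrow> ('a::real_normed_vector \<Rightarrow> ereal) \<Rightarrow> bool" where
  "strongly_smooth_fun \<epsilon> f \<longleftrightarrow> smooth_fun \<epsilon> f \<and> \<epsilon> > 0"

text \<open>
  Tuples indexed by \<open>{1..n}\<close> are functions on \<open>nat\<close>, whose values outside \<open>{1..n}\<close> are never used.
\<close>

definition proximal_average ::
  "real \<Rightarrow> nat \<Rightarrow> (nat \<Rightarrow> 'a::real_normed_vector \<Rightarrow> ereal) \<Rightarrow> (nat \<Rightarrow> real) \<Rightarrow> 'a \<Rightarrow> ereal" where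
  "proximal_average \<mu> n f lam x =
     ereal (1 / \<mu>) *
       (ereal (- (1 / 2) * (norm x)\<^sup>2) +
        (INF y \<in> {y :: nat \<Rightarrow> 'a. (\<Sum>i\<in>{1..n}. y i) = x}.
           \<Sum>i\<in>{1..n}. ereal (lam i) *
             (ereal \<mu> * f i (y i /\<^sub>R lam i) + ereal ((1 / 2) * (norm (y i /\<^sub>R lam i))\<^sup>2))))"

end

theory Submission
  imports Defs
begin

text \<open>
  Substituting \<open>y i = \<lambda>\<^sub>i u\<^sub>i\<close> turns the proximal average at \<open>x\<close> into the infimum of
  \<open>\<Sum> \<lambda>\<^sub>i f\<^sub>i(u\<^sub>i) + E(u) / (2 \<mu>)\<close> over all \<open>u\<close> with \<open>\<Sum> \<lambda>\<^sub>i u\<^sub>i = x\<close>, where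
  \<open>E(u) = \<Sum> \<lambda>\<^sub>i \<parallel>u\<^sub>i\<parallel>\<^sup>2 - \<parallel>\<Sum> \<lambda>\<^sub>i u\<^sub>i\<parallel>\<^sup>2\<close> is the weighted variance of \<open>u\<close>
  (\<open>proximal_average_le\<close>, \<open>proximal_average_less\<close>). Since \<open>E\<close> is a nonnegative quadratic form,
  the objective is jointly convex in \<open>u\<close>, so the infimum is convex in \<open>x\<close>. It is never
  \<open>-\<infinity>\<close>, because a proper lower semicontinuous convex function decreases at most linearly, while
  \<open>E(u)\<close> grows quadratically in \<open>u\<close> when \<open>x\<close> is fixed.

  For smoothness at \<open>z = (1 - t) x + t y\<close>, let \<open>w\<close> be nearly optimal for \<open>z\<close>, and split
  \<open>w\<^sub>i = (1 - t) u\<^sub>i + t v\<^sub>i\<close> with \<open>u\<^sub>i - v\<^sub>i = c\<^sub>i (x - y)\<close> and \<open>\<Sum> \<lambda>\<^sub>i c\<^sub>i = 1\<close>, so that \<open>u\<close> and \<open>v\<close>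
  are feasible for \<open>x\<close> and \<open>y\<close>. Smoothness of the \<open>f\<^sub>i\<close> and the parallelogram-type identity for
  \<open>E\<close> bound the loss by
  \<open>t (1 - t) / 2 * (\<Sum> \<lambda>\<^sub>i (1 / \<epsilon>\<^sub>i + 1 / \<mu>) c\<^sub>i\<^sup>2 - 1 / \<mu>) * \<parallel>x - y\<parallel>\<^sup>2\<close>.
  The minimising choice is \<open>c\<^sub>i\<close> proportional to \<open>\<epsilon>\<^sub>i / (\<epsilon>\<^sub>i + \<mu>)\<close>, which also vanishes when
  \<open>\<epsilon>\<^sub>i = 0\<close>, and with it the bracket equals \<open>1 / \<epsilon>\<close>.
\<close>

section \<open>The weighted variance\<close>

text \<open>
  The variance of the family \<open>u\<close> under the weights \<open>lam\<close>. The weights are not normalised here.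
\<close>

definition weighted_variance ::
  "'i set \<Rightarrow> ('i \<Rightarrow> real) \<Rightarrow> ('i \<Rightarrow> 'a::real_normed_vector) \<Rightarrow> real" where
  "weighted_variance I lam u =
     (\<Sum>i\<in>I. lam i * (norm (u i))\<^sup>2) - (norm (\<Sum>i\<in>I. lam i *\<^sub>R u i))\<^sup>2"

lemma norm_convex_combination_sq:
  fixes a b :: "'a::real_inner"
  shows "(norm ((1 - t) *\<^sub>R a + t *\<^sub>R b))\<^sup>2 =
    (1 - t) * (norm a)\<^sup>2 + t * (norm b)\<^sup>2 - t * (1 - t) * (norm (a - b))\<^sup>2"
  unfolding power2_norm_eq_inner
  by (simp add: inner_add_left inner_add_right inner_diff_left inner_diff_right inner_commute
      algebra_simps)

lemma weighted_sum_convex_combination: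
  fixes u v :: "'i \<Rightarrow> 'a::real_vector"
  shows "(\<Sum>i\<in>I. lam i *\<^sub>R ((1 - t) *\<^sub>R u i + t *\<^sub>R v i)) =
    (1 - t) *\<^sub>R (\<Sum>i\<in>I. lam i *\<^sub>R u i) + t *\<^sub>R (\<Sum>i\<in>I. lam i *\<^sub>R v i)"
  by (simp add: scaleR_sum_right sum.distrib scaleR_add_right mult.commute)

lemma weighted_variance_nonneg:
  fixes u :: "'i \<Rightarrow> 'a::real_inner"
  assumes "\<And>i. i \<in> I \<Longrightarrow> lam i \<ge> 0" and "(\<Sum>i\<in>I. lam i) = 1"
  shows "weighted_variance I lam u \<ge> 0"
proof -
  define x where "x = (\<Sum>i\<in>I. lam i *\<^sub>R u i)"
  have "(\<Sum>i\<in>I. lam i * (norm (u i - x))\<^sup>2) =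
      (\<Sum>i\<in>I. lam i * (norm (u i))\<^sup>2 - 2 * ((lam i *\<^sub>R u i) \<bullet> x) + lam i * (norm x)\<^sup>2)"
    by (intro sum.cong)
       (simp_all add: power2_norm_eq_inner inner_diff_left inner_diff_right inner_commute
         algebra_simps)
  also have "\<dots> = (\<Sum>i\<in>I. lam i * (norm (u i))\<^sup>2) - 2 * (x \<bullet> x) + (norm x)\<^sup>2"
    using assms(2)
    by (simp add: sum.distrib sum_subtractf x_def inner_sum_left
        flip: sum_distrib_left sum_distrib_right)
  also have "\<dots> = weighted_variance I lam u"
    by (simp add: weighted_variance_def x_def power2_norm_eq_inner)
  finally have "weighted_variance I lam u = (\<Sum>i\<in>I. lam i * (norm (u i - x))\<^sup>2)" ..
  then show ?thesis
    using assms(1) by (simp add: sum_nonneg)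
qed

lemma weighted_variance_convex_combination:
  fixes u v :: "'i \<Rightarrow> 'a::real_inner"
  shows "weighted_variance I lam (\<lambda>i. (1 - t) *\<^sub>R u i + t *\<^sub>R v i) =
    (1 - t) * weighted_variance I lam u + t * weighted_variance I lam v
      - t * (1 - t) * weighted_variance I lam (\<lambda>i. u i - v i)"
proof -
  have "(\<Sum>i\<in>I. lam i * (norm ((1 - t) *\<^sub>R u i + t *\<^sub>R v i))\<^sup>2) =
      (1 - t) * (\<Sum>i\<in>I. lam i * (norm (u i))\<^sup>2) + t * (\<Sum>i\<in>I. lam i * (norm (v i))\<^sup>2)
        - t * (1 - t) * (\<Sum>i\<in>I. lam i * (norm (u i - v i))\<^sup>2)"
    unfolding norm_convex_combination_sq sum_distrib_left sum.distrib[symmetric]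
      sum_subtractf[symmetric]
    by (intro sum.cong) (simp_all add: algebra_simps)
  then show ?thesis
    unfolding weighted_variance_def weighted_sum_convex_combination norm_convex_combination_sq
    by (simp add: scaleR_diff_right sum_subtractf right_diff_distrib distrib_left)
qed

lemma weighted_variance_scaleR:
  assumes "(\<Sum>i\<in>I. lam i * c i) = 1"
  shows "weighted_variance I lam (\<lambda>i. c i *\<^sub>R d) = ((\<Sum>i\<in>I. lam i * (c i)\<^sup>2) - 1) * (norm d)\<^sup>2"
proof -
  have "(\<Sum>i\<in>I. lam i *\<^sub>R c i *\<^sub>R d) = d"
    using assms by (simp flip: scaleR_sum_left)
  then show ?thesis
    by (simp add: weighted_variance_def power_mult_distrib sum_distrib_right left_diff_distrib
        mult.assoc)
qed

section \<open>Lower bounds for convex lower semicontinuous functions\<close>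

lemma ereal_convex_combination_real:
  "ereal (1 - t) * ereal a + ereal t * ereal b = ereal ((1 - t) * a + t * b)"
  by simp

text \<open>
  Near a point \<open>x0\<close> of the domain lower semicontinuity bounds \<open>f\<close> below by \<open>f x0 - 1\<close>; convexity
  along the ray from \<open>x0\<close> through \<open>u\<close> extends this to a bound that is affine in \<open>\<parallel>u - x0\<parallel>\<close>.
\<close>

lemma convex_lsc_linear_lower_bound:
  fixes f :: "'a::real_normed_vector \<Rightarrow> ereal"
  assumes "proper_fun f" "lsc_fun f" "convex_fun f"
  obtains r0 C x0 where "C > 0" "\<And>u. ereal (r0 - 1 - C * norm (u - x0)) \<le> f u"
proof -
  from assms(1) obtain x0 where "f x0 < \<infinity>" "f x0 \<noteq> -\<infinity>"
    by (auto simp: proper_fun_def)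
  then obtain r0 where r0: "f x0 = ereal r0"
    by (cases "f x0") auto
  have "f x0 \<le> Liminf (at x0) f"
    using assms(2) by (auto simp: lsc_fun_def)
  moreover have "ereal (r0 - 1) < f x0"
    by (simp add: r0)
  ultimately have "eventually (\<lambda>y. ereal (r0 - 1) < f y) (at x0)"
    by (auto simp: le_Liminf_iff)
  then obtain \<delta> where \<delta>: "\<delta> > 0" "\<And>y. y \<noteq> x0 \<Longrightarrow> dist y x0 < \<delta> \<Longrightarrow> ereal (r0 - 1) < f y"
    by (auto simp: eventually_at)
  have "ereal (r0 - 1 - (2 / \<delta>) * norm (u - x0)) \<le> f u" for u
  proof (cases "norm (u - x0) < \<delta>")
    case True
    have "ereal (r0 - 1) \<le> f u"
      using \<delta>(2)[of u] True r0 by (cases "u = x0") (auto simp: dist_norm intro: less_imp_le)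
    moreover have "ereal (r0 - 1 - (2 / \<delta>) * norm (u - x0)) \<le> ereal (r0 - 1)"
      using \<delta>(1) by simp
    ultimately show ?thesis
      by (rule order_trans[rotated])
  next
    case False
    define t where "t = \<delta> / (2 * norm (u - x0))"
    have pos: "norm (u - x0) > 0"
      using False \<delta>(1) by linarith
    have t: "0 < t" "t < 1"
      using False \<delta>(1) pos by (auto simp: t_def field_simps)
    define w where "w = (1 - t) *\<^sub>R x0 + t *\<^sub>R u"
    have "w - x0 = t *\<^sub>R (u - x0)"
      by (simp add: w_def algebra_simps)
    then have "norm (w - x0) = \<delta> / 2"
      using pos \<delta>(1) by (simp add: t_def)
    then have "ereal (r0 - 1) < f w"
      using \<delta> by (intro \<delta>(2)) (auto simp: dist_norm)
    also have "f w \<le> ereal (1 - t) * f x0 + ereal t * f u"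
      using assms(3) t by (auto simp: convex_fun_def w_def)
    finally have less: "ereal (r0 - 1) < ereal (1 - t) * ereal r0 + ereal t * f u"
      by (simp add: r0)
    show ?thesis
    proof (cases "f u")
      case (real s)
      have "r0 - 1 < (1 - t) * r0 + t * s"
        using less unfolding real ereal_convex_combination_real by simp
      then have "t * (r0 - 1 / t) < t * s"
        using t(1) by (simp add: algebra_simps)
      then have "r0 - 1 / t < s"
        using t(1) by simp
      moreover have "1 / t = (2 / \<delta>) * norm (u - x0)"
        using \<delta>(1) by (simp add: t_def)
      ultimately show ?thesis
        by (simp add: real)
    next
      case MInf
      then show ?thesis
        using assms(1) by (auto simp: proper_fun_def)
    qed simp
  qed
  then show ?thesis
    using that[of "2 / \<delta>" r0 x0] \<delta>(1) by simp
qed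

text \<open>
  The quadratic term absorbs the linear growth by completing the square; its factor
  \<open>1 / (2 \<mu>)\<close> is the one that the proximal average adds to the functions.
\<close>

lemma convex_lsc_quadratic_lower_bound:
  fixes f :: "'a::real_normed_vector \<Rightarrow> ereal"
  assumes "proper_fun f" "lsc_fun f" "convex_fun f" and "\<mu> > 0"
  shows "\<exists>M. \<forall>u. ereal (M - (norm u)\<^sup>2 / (2 * \<mu>)) \<le> f u"
proof -
  obtain r0 C x0 where C: "C > 0" "\<And>u. ereal (r0 - 1 - C * norm (u - x0)) \<le> f u"
    using convex_lsc_linear_lower_bound[OF assms(1-3)] by metis
  have "ereal (r0 - 1 - C * norm x0 - C\<^sup>2 * \<mu> / 2 - (norm u)\<^sup>2 / (2 * \<mu>)) \<le> f u" for u
  proof -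
    have "C * norm (u - x0) \<le> C * norm u + C * norm x0"
      using C(1) norm_triangle_ineq4[of u x0] by (simp flip: distrib_left)
    moreover have "0 \<le> (norm u - C * \<mu>)\<^sup>2 / (2 * \<mu>)"
      using assms(4) by simp
    then have "C * norm u \<le> C\<^sup>2 * \<mu> / 2 + (norm u)\<^sup>2 / (2 * \<mu>)"
      using assms(4) by (simp add: power2_eq_square field_simps)
    ultimately have "ereal (r0 - 1 - C * norm x0 - C\<^sup>2 * \<mu> / 2 - (norm u)\<^sup>2 / (2 * \<mu>))
        \<le> ereal (r0 - 1 - C * norm (u - x0))"
      by simp
    also note C(2)
    finally show ?thesis .
  qed
  then show ?thesis
    by blast
qed

section \<open>The proximal average as an infimum of real values\<close>

lemma ereal_scaled_shift_le_iff:
  "\<mu> > 0 \<Longrightarrow> ereal (1 / \<mu>) * (ereal c + J) \<le> ereal r \<longleftrightarrow> J \<le> ereal (\<mu> * r - c)"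
  by (cases J) (auto simp: field_simps)

lemma ereal_scaled_shift_less_iff:
  "\<mu> > 0 \<Longrightarrow> ereal (1 / \<mu>) * (ereal c + J) < ereal r \<longleftrightarrow> J < ereal (\<mu> * r - c)"
  by (cases J) (auto simp: field_simps)

text \<open>
  After the substitution the sum in the definition of the proximal average is \<open>\<mu>\<close> times the
  variance form of the objective plus half the squared norm of the point, which the term outside
  the infimum cancels.
\<close>

lemma sum_prox_objective:
  fixes r :: "'i \<Rightarrow> real"
  assumes "\<mu> > 0"
  shows "(\<Sum>i\<in>I. lam i * (\<mu> * r i + 1 / 2 * (norm (u i))\<^sup>2)) =
    \<mu> * ((\<Sum>i\<in>I. lam i * r i) + weighted_variance I lam u / (2 * \<mu>))
      - (- (1 / 2) * (norm (\<Sum>i\<in>I. lam i *\<^sub>R u i))\<^sup>2)"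
  using assms
  by (simp add: weighted_variance_def sum.distrib sum_distrib_left diff_divide_distrib
      distrib_left sum_divide_distrib right_diff_distrib mult.left_commute)

text \<open>
  The two lemmas below characterise the infimum defining the proximal average by real upper
  bounds; \<open>r i\<close> is an upper bound for \<open>f i (u i)\<close> in the first and its value in the second.
\<close>

lemma proximal_average_le:
  fixes f :: "nat \<Rightarrow> 'a::real_normed_vector \<Rightarrow> ereal"
  assumes "\<mu> > 0" and lam: "\<And>i. i \<in> {1..n} \<Longrightarrow> lam i > 0"
    and f: "\<And>i. i \<in> {1..n} \<Longrightarrow> f i (u i) \<le> ereal (r i)"
    and x: "(\<Sum>i\<in>{1..n}. lam i *\<^sub>R u i) = x"
  shows "proximal_average \<mu> n f lam x
    \<le> ereal ((\<Sum>i\<in>{1..n}. lam i * r i) + weighted_variance {1..n} lam u / (2 * \<mu>))"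
    (is "_ \<le> ereal ?b")
proof -
  let ?F = "\<lambda>y :: nat \<Rightarrow> 'a. \<Sum>i\<in>{1..n}. ereal (lam i) *
    (ereal \<mu> * f i (y i /\<^sub>R lam i) + ereal ((1 / 2) * (norm (y i /\<^sub>R lam i))\<^sup>2))"
  let ?Y = "{y :: nat \<Rightarrow> 'a. (\<Sum>i\<in>{1..n}. y i) = x}"
  have "(INF y \<in> ?Y. ?F y) \<le> ?F (\<lambda>i. lam i *\<^sub>R u i)"
    using x by (intro INF_lower) simp
  also have "\<dots> \<le> (\<Sum>i\<in>{1..n}. ereal (lam i * (\<mu> * r i + 1 / 2 * (norm (u i))\<^sup>2)))"
  proof (rule sum_mono)
    fix i assume i: "i \<in> {1..n}"
    have "ereal \<mu> * f i (u i) \<le> ereal \<mu> * ereal (r i)"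
      using assms(1) f[OF i] by (intro ereal_mult_left_mono) auto
    then have "ereal \<mu> * f i (u i) + ereal ((1 / 2) * (norm (u i))\<^sup>2)
        \<le> ereal \<mu> * ereal (r i) + ereal ((1 / 2) * (norm (u i))\<^sup>2)"
      by (rule add_right_mono)
    then have "ereal (lam i) * (ereal \<mu> * f i (u i) + ereal ((1 / 2) * (norm (u i))\<^sup>2))
        \<le> ereal (lam i) * (ereal \<mu> * ereal (r i) + ereal ((1 / 2) * (norm (u i))\<^sup>2))"
      using lam[OF i] by (intro ereal_mult_left_mono) auto
    then show "ereal (lam i) * (ereal \<mu> * f i ((lam i *\<^sub>R u i) /\<^sub>R lam i) +
          ereal ((1 / 2) * (norm ((lam i *\<^sub>R u i) /\<^sub>R lam i))\<^sup>2))
        \<le> ereal (lam i * (\<mu> * r i + 1 / 2 * (norm (u i))\<^sup>2))"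
      using lam[OF i] by simp
  qed
  also have "\<dots> = ereal (\<mu> * ?b - (- (1 / 2) * (norm x)\<^sup>2))"
    unfolding sum_ereal sum_prox_objective[OF assms(1)] x ..
  finally show ?thesis
    unfolding proximal_average_def ereal_scaled_shift_le_iff[OF assms(1)] .
qed

lemma proximal_average_less:
  fixes f :: "nat \<Rightarrow> 'a::real_normed_vector \<Rightarrow> ereal"
  assumes "\<mu> > 0" and lam: "\<And>i. i \<in> {1..n} \<Longrightarrow> lam i > 0"
    and proper: "\<And>i. i \<in> {1..n} \<Longrightarrow> proper_fun (f i)"
    and less: "proximal_average \<mu> n f lam x < ereal b"
  shows "\<exists>u r. (\<forall>i\<in>{1..n}. f i (u i) = ereal (r i)) \<and>
    (\<Sum>i\<in>{1..n}. lam i *\<^sub>R u i) = x \<and>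
    (\<Sum>i\<in>{1..n}. lam i * r i) + weighted_variance {1..n} lam u / (2 * \<mu>) < b"
proof -
  let ?F = "\<lambda>y :: nat \<Rightarrow> 'a. \<Sum>i\<in>{1..n}. ereal (lam i) *
    (ereal \<mu> * f i (y i /\<^sub>R lam i) + ereal ((1 / 2) * (norm (y i /\<^sub>R lam i))\<^sup>2))"
  from less obtain y :: "nat \<Rightarrow> 'a" where y: "(\<Sum>i\<in>{1..n}. y i) = x"
    and Fy: "?F y < ereal (\<mu> * b - (- (1 / 2) * (norm x)\<^sup>2))"
    unfolding proximal_average_def ereal_scaled_shift_less_iff[OF assms(1)] INF_less_iff
    by blast
  define u where "u = (\<lambda>i. y i /\<^sub>R lam i)"
  define r where "r = (\<lambda>i. real_of_ereal (f i (u i)))"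
  have r: "f i (u i) = ereal (r i)" if i: "i \<in> {1..n}" for i
  proof -
    have "?F y \<noteq> \<infinity>"
      using Fy by auto
    then have "ereal (lam i) * (ereal \<mu> * f i (u i) + ereal ((1 / 2) * (norm (u i))\<^sup>2)) \<noteq> \<infinity>"
      using i unfolding sum_Pinfty u_def by blast
    then have "f i (u i) \<noteq> \<infinity>"
      using assms(1) lam[OF i] by auto
    moreover have "f i (u i) \<noteq> -\<infinity>"
      using proper[OF i] by (auto simp: proper_fun_def)
    ultimately show ?thesis
      by (auto simp: r_def ereal_real)
  qed
  have x: "(\<Sum>i\<in>{1..n}. lam i *\<^sub>R u i) = x"
    unfolding y[symmetric]
  proof (rule sum.cong)
    fix i assume "i \<in> {1..n}"
    then show "lam i *\<^sub>R u i = y i"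
      using lam[of i] by (simp add: u_def)
  qed simp
  have "?F y = (\<Sum>i\<in>{1..n}. ereal (lam i * (\<mu> * r i + 1 / 2 * (norm (u i))\<^sup>2)))"
  proof (rule sum.cong)
    fix i assume "i \<in> {1..n}"
    then show "ereal (lam i) * (ereal \<mu> * f i (y i /\<^sub>R lam i)
          + ereal ((1 / 2) * (norm (y i /\<^sub>R lam i))\<^sup>2))
        = ereal (lam i * (\<mu> * r i + 1 / 2 * (norm (u i))\<^sup>2))"
      using r[of i] unfolding u_def by simp
  qed simp
  with Fy have "\<mu> * ((\<Sum>i\<in>{1..n}. lam i * r i) + weighted_variance {1..n} lam u / (2 * \<mu>))
      < \<mu> * b"
    unfolding sum_ereal sum_prox_objective[OF assms(1)] x by simp
  then have "(\<Sum>i\<in>{1..n}. lam i * r i) + weighted_variance {1..n} lam u / (2 * \<mu>) < b"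
    using assms(1) by simp
  with r x show ?thesis
    by blast
qed

section \<open>Properness and convexity of the proximal average\<close>

lemma proper_proximal_average:
  fixes f :: "nat \<Rightarrow> 'a::real_inner \<Rightarrow> ereal"
  assumes "\<mu> > 0" and lam: "\<And>i. i \<in> {1..n} \<Longrightarrow> lam i > 0"
    and proper: "\<And>i. i \<in> {1..n} \<Longrightarrow> proper_fun (f i)"
    and lsc: "\<And>i. i \<in> {1..n} \<Longrightarrow> lsc_fun (f i)"
    and conv: "\<And>i. i \<in> {1..n} \<Longrightarrow> convex_fun (f i)"
  shows "proper_fun (proximal_average \<mu> n f lam)"
  unfolding proper_fun_def
proof (intro conjI allI)
  fix x :: 'a
  have "\<forall>i\<in>{1..n}. \<exists>M. \<forall>u. ereal (M - (norm u)\<^sup>2 / (2 * \<mu>)) \<le> f i u"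
    using convex_lsc_quadratic_lower_bound[OF proper lsc conv assms(1)] by blast
  then obtain M where M: "\<And>i u. i \<in> {1..n} \<Longrightarrow> ereal (M i - (norm u)\<^sup>2 / (2 * \<mu>)) \<le> f i u"
    by metis
  define b where "b = (\<Sum>i\<in>{1..n}. lam i * M i) - (norm x)\<^sup>2 / (2 * \<mu>)"
  show "proximal_average \<mu> n f lam x \<noteq> -\<infinity>"
  proof
    assume "proximal_average \<mu> n f lam x = -\<infinity>"
    then have lt: "proximal_average \<mu> n f lam x < ereal b"
      by simp
    obtain u r where r: "\<And>i. i \<in> {1..n} \<Longrightarrow> f i (u i) = ereal (r i)"
      and x: "(\<Sum>i\<in>{1..n}. lam i *\<^sub>R u i) = x"
      and less: "(\<Sum>i\<in>{1..n}. lam i * r i) + weighted_variance {1..n} lam u / (2 * \<mu>) < b"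
      using proximal_average_less[of \<mu> n lam f, OF assms(1) lam proper lt] by blast
    have "(\<Sum>i\<in>{1..n}. lam i * (M i - (norm (u i))\<^sup>2 / (2 * \<mu>))) \<le> (\<Sum>i\<in>{1..n}. lam i * r i)"
    proof (intro sum_mono mult_left_mono)
      fix i assume "i \<in> {1..n}"
      then show "M i - (norm (u i))\<^sup>2 / (2 * \<mu>) \<le> r i" "0 \<le> lam i"
        using M[of i "u i"] r[of i] lam[of i] by auto
    qed
    moreover have "(\<Sum>i\<in>{1..n}. lam i * (M i - (norm (u i))\<^sup>2 / (2 * \<mu>)))
        + weighted_variance {1..n} lam u / (2 * \<mu>) = b"
      unfolding b_def weighted_variance_def x
      by (simp add: right_diff_distrib sum_subtractf sum_divide_distrib diff_divide_distrib)
    ultimately show False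
      using less by linarith
  qed
next
  have "\<forall>i\<in>{1..n}. \<exists>u r. f i u \<le> ereal r"
  proof
    fix i assume "i \<in> {1..n}"
    then obtain u where "f i u < \<infinity>"
      using proper by (auto simp: proper_fun_def)
    then obtain m :: nat where "f i u < ereal (real m)"
      using less_PInf_Ex_of_nat[of "f i u"] by auto
    then show "\<exists>u r. f i u \<le> ereal r"
      by (intro exI less_imp_le)
  qed
  then obtain u r where ur: "\<And>i. i \<in> {1..n} \<Longrightarrow> f i (u i) \<le> ereal (r i)"
    by metis
  from proximal_average_le[of \<mu> n lam f, OF assms(1) lam ur refl]
  have "proximal_average \<mu> n f lam (\<Sum>i\<in>{1..n}. lam i *\<^sub>R u i) < \<infinity>"
    by (rule order_le_less_trans) auto
  then show "\<exists>x. proximal_average \<mu> n f lam x < \<infinity>"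
    by blast
qed

lemma convex_fun_if_strict_epigraph_convex:
  fixes g :: "'a::real_vector \<Rightarrow> ereal"
  assumes not_MInf: "\<And>x. g x \<noteq> -\<infinity>"
    and epi: "\<And>x y t a b. 0 < t \<Longrightarrow> t < 1 \<Longrightarrow> g x < ereal a \<Longrightarrow> g y < ereal b \<Longrightarrow>
      g ((1 - t) *\<^sub>R x + t *\<^sub>R y) \<le> ereal ((1 - t) * a + t * b)"
  shows "convex_fun g"
  unfolding convex_fun_def
proof (intro allI ballI)
  fix x y and t :: real
  assume "t \<in> {0<..<1}"
  then have t: "0 < t" "t < 1"
    by auto
  show "g ((1 - t) *\<^sub>R x + t *\<^sub>R y) \<le> ereal (1 - t) * g x + ereal t * g y"
  proof (cases "g x = \<infinity> \<or> g y = \<infinity>")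
    case True
    then have "ereal (1 - t) * g x + ereal t * g y = \<infinity>"
      using t not_MInf[of x] not_MInf[of y] by (cases "g x"; cases "g y") auto
    then show ?thesis
      by (simp only: ereal_less_eq(1))
  next
    case False
    then obtain a b where ab: "g x = ereal a" "g y = ereal b"
      using not_MInf by (metis ereal_cases)
    show ?thesis
      unfolding ab ereal_convex_combination_real
    proof (rule ereal_le_epsilon2)
      fix e :: real assume e: "e > 0"
      have "g ((1 - t) *\<^sub>R x + t *\<^sub>R y) \<le> ereal ((1 - t) * (a + e) + t * (b + e))"
        using t e ab by (intro epi) auto
      also have "(1 - t) * (a + e) + t * (b + e) = (1 - t) * a + t * b + e"
        by (simp add: algebra_simps)
      finally show "g ((1 - t) *\<^sub>R x + t *\<^sub>R y) \<le> ereal ((1 - t) * a + t * b) + ereal e"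
        by simp
    qed
  qed
qed

lemma convex_proximal_average:
  fixes f :: "nat \<Rightarrow> 'a::real_inner \<Rightarrow> ereal"
  assumes "\<mu> > 0" and lam: "\<And>i. i \<in> {1..n} \<Longrightarrow> lam i > 0"
    and lam_sum: "(\<Sum>i\<in>{1..n}. lam i) = 1"
    and proper: "\<And>i. i \<in> {1..n} \<Longrightarrow> proper_fun (f i)"
    and lsc: "\<And>i. i \<in> {1..n} \<Longrightarrow> lsc_fun (f i)"
    and conv: "\<And>i. i \<in> {1..n} \<Longrightarrow> convex_fun (f i)"
  shows "convex_fun (proximal_average \<mu> n f lam)"
proof (rule convex_fun_if_strict_epigraph_convex)
  show "proximal_average \<mu> n f lam x \<noteq> -\<infinity>" for x
    using proper_proximal_average[of \<mu> n lam f, OF assms(1) lam proper lsc conv] by (simp add: proper_fun_def)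
next
  fix x y and t a b :: real
  assume t: "0 < t" "t < 1"
  let ?E = "weighted_variance {1..n} lam"
  assume less_a: "proximal_average \<mu> n f lam x < ereal a"
  obtain u r where r: "\<And>i. i \<in> {1..n} \<Longrightarrow> f i (u i) = ereal (r i)"
    and x: "(\<Sum>i\<in>{1..n}. lam i *\<^sub>R u i) = x"
    and a: "(\<Sum>i\<in>{1..n}. lam i * r i) + ?E u / (2 * \<mu>) < a"
    using proximal_average_less[of \<mu> n lam f, OF assms(1) lam proper less_a] by blast
  assume less_b: "proximal_average \<mu> n f lam y < ereal b"
  obtain v s where s: "\<And>i. i \<in> {1..n} \<Longrightarrow> f i (v i) = ereal (s i)"
    and y: "(\<Sum>i\<in>{1..n}. lam i *\<^sub>R v i) = y"
    and b: "(\<Sum>i\<in>{1..n}. lam i * s i) + ?E v / (2 * \<mu>) < b"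
    using proximal_average_less[of \<mu> n lam f, OF assms(1) lam proper less_b] by blast
  define w where "w = (\<lambda>i. (1 - t) *\<^sub>R u i + t *\<^sub>R v i)"
  have f_w: "f i (w i) \<le> ereal ((1 - t) * r i + t * s i)" if "i \<in> {1..n}" for i
    unfolding w_def ereal_convex_combination_real[symmetric]
      r[OF that, symmetric] s[OF that, symmetric]
    using conv[OF that] t by (simp only: convex_fun_def Ball_def greaterThanLessThan_iff simp_thms)
  have w: "(\<Sum>i\<in>{1..n}. lam i *\<^sub>R w i) = (1 - t) *\<^sub>R x + t *\<^sub>R y"
    unfolding w_def weighted_sum_convex_combination x y ..
  have "0 \<le> t * (1 - t) * ?E (\<lambda>i. u i - v i)"
    using t lam lam_sum
    by (intro mult_nonneg_nonneg weighted_variance_nonneg) (auto intro: less_imp_le)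
  then have "?E w \<le> (1 - t) * ?E u + t * ?E v"
    unfolding w_def weighted_variance_convex_combination by simp
  then have "?E w / (2 * \<mu>) \<le> ((1 - t) * ?E u + t * ?E v) / (2 * \<mu>)"
    using assms(1) by (intro divide_right_mono) auto
  then have "(\<Sum>i\<in>{1..n}. lam i * ((1 - t) * r i + t * s i)) + ?E w / (2 * \<mu>)
      \<le> (1 - t) * ((\<Sum>i\<in>{1..n}. lam i * r i) + ?E u / (2 * \<mu>))
        + t * ((\<Sum>i\<in>{1..n}. lam i * s i) + ?E v / (2 * \<mu>))"
    by (simp add: distrib_left sum.distrib sum_distrib_left add_divide_distrib mult.left_commute)
  also have "\<dots> \<le> (1 - t) * a + t * b"
    using t a b by (intro add_mono mult_left_mono) auto
  finally show "proximal_average \<mu> n f lam ((1 - t) *\<^sub>R x + t *\<^sub>R y) \<le> ereal ((1 - t) * a + t * b)"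
    using order_trans[OF proximal_average_le[of \<mu> n lam f w, OF assms(1) lam f_w w]] by simp
qed

section \<open>Smoothness of the proximal average\<close>

text \<open>
  Writing the increment as \<open>u - v = e h\<close> cancels the division by \<open>e\<close> in the definition of
  smoothness, so that the case \<open>e = 0\<close>, where \<open>u = v\<close>, obeys the same bound.
\<close>

lemma smooth_fun_bound:
  fixes g :: "'a::real_normed_vector \<Rightarrow> ereal"
  assumes g: "smooth_fun e g" and t: "0 < t" "t < 1"
    and r: "g ((1 - t) *\<^sub>R u + t *\<^sub>R v) = ereal r" and h: "u - v = e *\<^sub>R h"
  shows "\<exists>a b. g u = ereal a \<and> g v = ereal b \<and>
    (1 - t) * a + t * b \<le> r + t * (1 - t) * (e / 2) * (norm h)\<^sup>2"
proof (cases "e = 0")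
  case True
  then have "u = v"
    using h by simp
  then have "(1 - t) *\<^sub>R u + t *\<^sub>R v = u"
    by (simp add: algebra_simps)
  then show ?thesis
    using r True \<open>u = v\<close> by (intro exI[of _ r]) (simp add: algebra_simps)
next
  case False
  then have e: "e > 0"
    using g by (simp add: smooth_fun_def)
  have not_MInf: "g u \<noteq> -\<infinity>" "g v \<noteq> -\<infinity>"
    using g by (auto simp: smooth_fun_def proper_fun_def)
  have smooth_e: "g ((1 - t) *\<^sub>R x + t *\<^sub>R y) < \<infinity> \<Longrightarrow>
      ereal (1 - t) * g x + ereal t * g y
      \<le> g ((1 - t) *\<^sub>R x + t *\<^sub>R y) + ereal (t * (1 - t) * (1 / (2 * e)) * (norm (x - y))\<^sup>2)" for x y
    using g t e unfolding smooth_fun_def by (simp only: simp_thms greaterThanLessThan_iff Ball_def)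
  have "t * (1 - t) * (1 / (2 * e)) * (norm (u - v))\<^sup>2 = t * (1 - t) * (e / 2) * (norm h)\<^sup>2"
    using e by (simp add: h power_mult_distrib power2_eq_square)
  moreover have "ereal (1 - t) * g u + ereal t * g v
      \<le> ereal r + ereal (t * (1 - t) * (1 / (2 * e)) * (norm (u - v))\<^sup>2)"
    using smooth_e[of u v] unfolding r by (simp del: plus_ereal.simps)
  ultimately have bound: "ereal (1 - t) * g u + ereal t * g v
      \<le> ereal (r + t * (1 - t) * (e / 2) * (norm h)\<^sup>2)"
    by (simp only: plus_ereal.simps)
  obtain a b where "g u = ereal a" "g v = ereal b"
    using bound not_MInf t by (cases "g u"; cases "g v") auto
  with bound show ?thesis
    by auto
qed

text \<open>
  The weights \<open>\<epsilon>\<^sub>i / (\<epsilon>\<^sub>i + \<mu>)\<close> used to distribute an increment sum to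
  \<open>\<kappa> = 1 - \<mu> S\<close>, where \<open>S = \<Sum> \<lambda>\<^sub>i / (\<epsilon>\<^sub>i + \<mu>)\<close>.
\<close>

lemma sum_weights_complement:
  fixes lam \<epsilon>s :: "'i \<Rightarrow> real"
  assumes "\<mu> > 0" and "\<And>i. i \<in> I \<Longrightarrow> \<epsilon>s i \<ge> 0" and "(\<Sum>i\<in>I. lam i) = 1"
  shows "(\<Sum>i\<in>I. lam i * (\<epsilon>s i / (\<epsilon>s i + \<mu>))) = 1 - \<mu> * (\<Sum>i\<in>I. lam i * inverse (\<epsilon>s i + \<mu>))"
proof -
  have "(\<Sum>i\<in>I. lam i * (\<epsilon>s i / (\<epsilon>s i + \<mu>))) = (\<Sum>i\<in>I. lam i - \<mu> * (lam i * inverse (\<epsilon>s i + \<mu>)))"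
  proof (rule sum.cong)
    fix i assume "i \<in> I"
    then have "\<epsilon>s i + \<mu> > 0"
      using assms(1) assms(2)[of i] by linarith
    then show "lam i * (\<epsilon>s i / (\<epsilon>s i + \<mu>)) = lam i - \<mu> * (lam i * inverse (\<epsilon>s i + \<mu>))"
      by (simp add: field_simps)
  qed simp
  then show ?thesis
    using assms(3) by (simp add: sum_subtractf sum_distrib_left)
qed

text \<open>
  The total loss factor for the fractions \<open>c\<^sub>i = \<epsilon>\<^sub>i / ((\<epsilon>\<^sub>i + \<mu>) \<kappa>)\<close>: the first sum comes from
  the smoothness of the individual functions, the remainder from the variance term. Here
  \<open>\<kappa> = 1 - \<mu> S\<close>.
\<close>

lemma optimal_split_constant:
  fixes lam \<epsilon>s :: "'i \<Rightarrow> real"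
  assumes "\<mu> > 0" and eps: "\<And>i. i \<in> I \<Longrightarrow> \<epsilon>s i \<ge> 0" and "(\<Sum>i\<in>I. lam i) = 1"
    and S: "S = (\<Sum>i\<in>I. lam i * inverse (\<epsilon>s i + \<mu>))" "S > 0" and "1 - \<mu> * S > 0"
  shows "(\<Sum>i\<in>I. lam i * (\<epsilon>s i / ((\<epsilon>s i + \<mu>) * (1 - \<mu> * S))\<^sup>2))
    + ((\<Sum>i\<in>I. lam i * (\<epsilon>s i / (\<epsilon>s i + \<mu>) / (1 - \<mu> * S))\<^sup>2) - 1) / \<mu> = 1 / (inverse S - \<mu>)"
proof -
  define \<kappa> where "\<kappa> = 1 - \<mu> * S"
  have \<kappa>: "\<kappa> > 0"
    using assms(6) by (simp add: \<kappa>_def)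
  have \<kappa>_sum: "(\<Sum>i\<in>I. lam i * (\<epsilon>s i / (\<epsilon>s i + \<mu>))) = \<kappa>"
    unfolding \<kappa>_def S(1) using assms(1,2,3) by (rule sum_weights_complement)
  have "(\<Sum>i\<in>I. lam i * (\<epsilon>s i / ((\<epsilon>s i + \<mu>) * \<kappa>)\<^sup>2))
      + (\<Sum>i\<in>I. lam i * (\<epsilon>s i / (\<epsilon>s i + \<mu>) / \<kappa>)\<^sup>2) / \<mu>
      = (\<Sum>i\<in>I. lam i * (\<epsilon>s i / (\<epsilon>s i + \<mu>)) / (\<mu> * \<kappa>\<^sup>2))"
    unfolding sum_divide_distrib sum.distrib[symmetric]
  proof (rule sum.cong)
    fix i assume "i \<in> I"
    define m where "m = \<epsilon>s i + \<mu>"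
    have m: "m > 0"
      using assms(1) eps[OF \<open>i \<in> I\<close>] by (simp add: m_def)
    have "\<epsilon>s i / (m * \<kappa>)\<^sup>2 + (\<epsilon>s i / m / \<kappa>)\<^sup>2 / \<mu> = \<epsilon>s i * (\<mu> + \<epsilon>s i) / (\<mu> * (m * \<kappa>)\<^sup>2)"
      using m \<kappa> assms(1) by (simp add: divide_simps) (simp add: power2_eq_square algebra_simps)
    also have "\<dots> = \<epsilon>s i * m / (\<mu> * (m * \<kappa>)\<^sup>2)"
      by (simp add: m_def add.commute)
    also have "\<dots> = \<epsilon>s i / m / (\<mu> * \<kappa>\<^sup>2)"
      using m by (simp add: power2_eq_square)
    finally have "lam i * (\<epsilon>s i / (m * \<kappa>)\<^sup>2 + (\<epsilon>s i / m / \<kappa>)\<^sup>2 / \<mu>) = lam i * (\<epsilon>s i / m / (\<mu> * \<kappa>\<^sup>2))"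
      by (rule arg_cong)
    then show "lam i * (\<epsilon>s i / ((\<epsilon>s i + \<mu>) * \<kappa>)\<^sup>2) + lam i * (\<epsilon>s i / (\<epsilon>s i + \<mu>) / \<kappa>)\<^sup>2 / \<mu>
        = lam i * (\<epsilon>s i / (\<epsilon>s i + \<mu>)) / (\<mu> * \<kappa>\<^sup>2)"
      unfolding m_def[symmetric] distrib_left times_divide_eq_right .
  qed simp
  also have "\<dots> = (\<Sum>i\<in>I. lam i * (\<epsilon>s i / (\<epsilon>s i + \<mu>))) / (\<mu> * \<kappa>\<^sup>2)"
    by (rule sum_divide_distrib[symmetric])
  also have "\<dots> = 1 / (\<mu> * \<kappa>)"
    unfolding \<kappa>_sum using \<kappa> by (simp add: power2_eq_square)
  finally have "(\<Sum>i\<in>I. lam i * (\<epsilon>s i / ((\<epsilon>s i + \<mu>) * \<kappa>)\<^sup>2))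
      + ((\<Sum>i\<in>I. lam i * (\<epsilon>s i / (\<epsilon>s i + \<mu>) / \<kappa>)\<^sup>2) - 1) / \<mu> = 1 / (\<mu> * \<kappa>) - 1 / \<mu>"
    by (simp only: diff_divide_distrib add_diff_eq)
  also have "\<dots> = (1 - \<kappa>) / (\<mu> * \<kappa>)"
    using \<kappa> assms(1) by (simp add: field_simps)
  also have "\<dots> = S / \<kappa>"
    using assms(1) by (simp add: \<kappa>_def)
  also have "\<dots> = 1 / (inverse S - \<mu>)"
    using S(2) by (simp add: \<kappa>_def field_simps)
  finally show ?thesis
    unfolding \<kappa>_def .
qed

text \<open>
  The smoothness inequality, with an arbitrary real upper bound \<open>b\<close> in place of the value at the
  intermediate point, since the infimum there need not be attained.
\<close>

lemma smooth_inequality_proximal_average: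
  fixes f :: "nat \<Rightarrow> 'a::real_inner \<Rightarrow> ereal"
  assumes "\<mu> > 0" and lam: "\<And>i. i \<in> {1..n} \<Longrightarrow> lam i > 0"
    and lam_sum: "(\<Sum>i\<in>{1..n}. lam i) = 1"
    and eps: "\<And>i. i \<in> {1..n} \<Longrightarrow> \<epsilon>s i \<ge> 0"
    and smooth: "\<And>i. i \<in> {1..n} \<Longrightarrow> smooth_fun (\<epsilon>s i) (f i)"
    and S: "S = (\<Sum>i\<in>{1..n}. lam i * inverse (\<epsilon>s i + \<mu>))" "S > 0" "inverse S - \<mu> > 0"
    and t: "0 < t" "t < 1"
    and less: "proximal_average \<mu> n f lam ((1 - t) *\<^sub>R x + t *\<^sub>R y) < ereal b"
  shows "ereal (1 - t) * proximal_average \<mu> n f lam x + ereal t * proximal_average \<mu> n f lam y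
    \<le> ereal (b + t * (1 - t) * (1 / (2 * (inverse S - \<mu>))) * (norm (x - y))\<^sup>2)"
proof -
  let ?E = "weighted_variance {1..n} lam"
  define d where "d = x - y"
  define \<kappa> where "\<kappa> = 1 - \<mu> * S"
  have \<kappa>: "\<kappa> > 0"
    using S(2,3) by (simp add: \<kappa>_def field_simps)
  have \<kappa>_sum: "(\<Sum>i\<in>{1..n}. lam i * (\<epsilon>s i / (\<epsilon>s i + \<mu>))) = \<kappa>"
    unfolding \<kappa>_def S(1) using sum_weights_complement[OF assms(1) eps lam_sum] .
  have pos: "\<epsilon>s i + \<mu> > 0" if "i \<in> {1..n}" for i
    using eps[OF that] assms(1) by linarith
  \<comment> \<open>The fractions of \<open>d\<close> minimising \<open>\<Sum> \<lambda>\<^sub>i (1 / \<epsilon>\<^sub>i + 1 / \<mu>) c\<^sub>i\<^sup>2\<close> subject to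
    \<open>\<Sum> \<lambda>\<^sub>i c\<^sub>i = 1\<close>, with \<open>c\<^sub>i = 0\<close> where \<open>\<epsilon>\<^sub>i = 0\<close>.\<close>
  define c where "c = (\<lambda>i. \<epsilon>s i / (\<epsilon>s i + \<mu>) / \<kappa>)"
  define h where "h = (\<lambda>i. (1 / ((\<epsilon>s i + \<mu>) * \<kappa>)) *\<^sub>R d)"
  have c_h: "c i *\<^sub>R d = \<epsilon>s i *\<^sub>R h i" for i
    by (simp add: c_def h_def)
  have c_sum: "(\<Sum>i\<in>{1..n}. lam i * c i) = 1"
  proof -
    have "(\<Sum>i\<in>{1..n}. lam i * c i) = (\<Sum>i\<in>{1..n}. lam i * (\<epsilon>s i / (\<epsilon>s i + \<mu>))) / \<kappa>"
      by (simp add: c_def sum_divide_distrib)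
    then show ?thesis
      using \<kappa> \<kappa>_sum by simp
  qed
  have proper: "\<And>i. i \<in> {1..n} \<Longrightarrow> proper_fun (f i)"
    using smooth by (simp add: smooth_fun_def)
  obtain w r where r: "\<And>i. i \<in> {1..n} \<Longrightarrow> f i (w i) = ereal (r i)"
    and w: "(\<Sum>i\<in>{1..n}. lam i *\<^sub>R w i) = (1 - t) *\<^sub>R x + t *\<^sub>R y"
    and wb: "(\<Sum>i\<in>{1..n}. lam i * r i) + ?E w / (2 * \<mu>) < b"
    using proximal_average_less[of \<mu> n lam f, OF assms(1) lam proper less] by blast
  \<comment> \<open>Split \<open>w\<close> into families feasible for \<open>x\<close> and \<open>y\<close> whose difference at \<open>i\<close> is \<open>c i *\<^sub>R d\<close>.\<close>
  define u where "u = (\<lambda>i. w i + (t * c i) *\<^sub>R d)"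
  define v where "v = (\<lambda>i. w i - ((1 - t) * c i) *\<^sub>R d)"
  have w_uv: "w i = (1 - t) *\<^sub>R u i + t *\<^sub>R v i" for i
    by (simp add: u_def v_def algebra_simps)
  have uv: "u i - v i = c i *\<^sub>R d" for i
    by (simp add: u_def v_def algebra_simps)
  have sum_shift: "(\<Sum>i\<in>{1..n}. lam i *\<^sub>R (k * c i) *\<^sub>R d) = k *\<^sub>R d" for k
    using c_sum
    by (simp add: mult.left_commute flip: scaleR_sum_left sum_distrib_left)
  have x: "(\<Sum>i\<in>{1..n}. lam i *\<^sub>R u i) = x"
    unfolding u_def scaleR_add_right sum.distrib sum_shift w by (simp add: d_def algebra_simps)
  have y: "(\<Sum>i\<in>{1..n}. lam i *\<^sub>R v i) = y"
    unfolding v_def scaleR_diff_right sum_subtractf sum_shift w by (simp add: d_def algebra_simps)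
  have "\<forall>i\<in>{1..n}. \<exists>p q. f i (u i) = ereal p \<and> f i (v i) = ereal q \<and>
      (1 - t) * p + t * q \<le> r i + t * (1 - t) * (\<epsilon>s i / 2) * (norm (h i))\<^sup>2"
  proof
    fix i assume i: "i \<in> {1..n}"
    show "\<exists>p q. f i (u i) = ereal p \<and> f i (v i) = ereal q \<and>
        (1 - t) * p + t * q \<le> r i + t * (1 - t) * (\<epsilon>s i / 2) * (norm (h i))\<^sup>2"
      using smooth_fun_bound[OF smooth[OF i] t] r[OF i] uv[of i]
      unfolding w_uv[of i] c_h[of i] by blast
  qed
  then obtain p q where p: "\<And>i. i \<in> {1..n} \<Longrightarrow> f i (u i) = ereal (p i)"
    and q: "\<And>i. i \<in> {1..n} \<Longrightarrow> f i (v i) = ereal (q i)"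
    and pq: "\<And>i. i \<in> {1..n} \<Longrightarrow>
      (1 - t) * p i + t * q i \<le> r i + t * (1 - t) * (\<epsilon>s i / 2) * (norm (h i))\<^sup>2"
    by metis
  define A where "A = (\<Sum>i\<in>{1..n}. lam i * p i) + ?E u / (2 * \<mu>)"
  define B where "B = (\<Sum>i\<in>{1..n}. lam i * q i) + ?E v / (2 * \<mu>)"
  have "proximal_average \<mu> n f lam x \<le> ereal A" "proximal_average \<mu> n f lam y \<le> ereal B"
    unfolding A_def B_def
    using proximal_average_le[of \<mu> n lam f u p x, OF assms(1) lam _ x]
      proximal_average_le[of \<mu> n lam f v q y, OF assms(1) lam _ y] p q
    by simp_all
  then have "ereal (1 - t) * proximal_average \<mu> n f lam x + ereal t * proximal_average \<mu> n f lam y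
      \<le> ereal (1 - t) * ereal A + ereal t * ereal B"
    using t by (intro add_mono ereal_mult_left_mono) auto
  also have "\<dots> = ereal ((1 - t) * A + t * B)"
    by simp
  also have "(1 - t) * A + t * B \<le> b + t * (1 - t) * (1 / (2 * (inverse S - \<mu>))) * (norm (x - y))\<^sup>2"
  proof -
    let ?X = "\<Sum>i\<in>{1..n}. lam i * (\<epsilon>s i / ((\<epsilon>s i + \<mu>) * \<kappa>)\<^sup>2)"
    let ?Y = "\<Sum>i\<in>{1..n}. lam i * (c i)\<^sup>2"
    have var: "(1 - t) * ?E u + t * ?E v = ?E w + t * (1 - t) * ((?Y - 1) * (norm d)\<^sup>2)"
      using weighted_variance_convex_combination[of "{1..n}" lam t u v]
      unfolding w_uv[symmetric] uv weighted_variance_scaleR[OF c_sum] by simp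
    have "(1 - t) * (\<Sum>i\<in>{1..n}. lam i * p i) + t * (\<Sum>i\<in>{1..n}. lam i * q i)
        = (\<Sum>i\<in>{1..n}. lam i * ((1 - t) * p i + t * q i))"
      by (simp add: distrib_left sum.distrib sum_distrib_left mult.left_commute)
    also have "\<dots> \<le> (\<Sum>i\<in>{1..n}. lam i * (r i + t * (1 - t) * (\<epsilon>s i / 2) * (norm (h i))\<^sup>2))"
    proof (intro sum_mono mult_left_mono)
      fix i assume "i \<in> {1..n}"
      then show "(1 - t) * p i + t * q i \<le> r i + t * (1 - t) * (\<epsilon>s i / 2) * (norm (h i))\<^sup>2"
        and "0 \<le> lam i"
        using pq lam[of i] by simp_all
    qed
    also have "\<dots> = (\<Sum>i\<in>{1..n}. lam i * r i) + t * (1 - t) / 2 * (norm d)\<^sup>2 * ?X"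
      unfolding sum_distrib_left sum.distrib[symmetric]
    proof (rule sum.cong)
      fix i
      have "(norm (h i))\<^sup>2 = (norm d)\<^sup>2 / ((\<epsilon>s i + \<mu>) * \<kappa>)\<^sup>2"
        by (simp add: h_def power_mult_distrib power_divide)
      then show "lam i * (r i + t * (1 - t) * (\<epsilon>s i / 2) * (norm (h i))\<^sup>2)
          = lam i * r i
            + t * (1 - t) / 2 * (norm d)\<^sup>2 * (lam i * (\<epsilon>s i / ((\<epsilon>s i + \<mu>) * \<kappa>)\<^sup>2))"
        by (simp add: distrib_left)
    qed simp
    finally have "(1 - t) * (\<Sum>i\<in>{1..n}. lam i * p i) + t * (\<Sum>i\<in>{1..n}. lam i * q i)
        \<le> (\<Sum>i\<in>{1..n}. lam i * r i) + t * (1 - t) / 2 * (norm d)\<^sup>2 * ?X" .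
    moreover have "(1 - t) * A + t * B = ((1 - t) * (\<Sum>i\<in>{1..n}. lam i * p i)
        + t * (\<Sum>i\<in>{1..n}. lam i * q i)) + ((1 - t) * ?E u + t * ?E v) / (2 * \<mu>)"
      by (simp add: A_def B_def distrib_left add_divide_distrib)
    ultimately have "(1 - t) * A + t * B
        \<le> ((\<Sum>i\<in>{1..n}. lam i * r i) + t * (1 - t) / 2 * (norm d)\<^sup>2 * ?X)
          + (?E w + t * (1 - t) * ((?Y - 1) * (norm d)\<^sup>2)) / (2 * \<mu>)"
      unfolding var by linarith
    also have "\<dots> = ((\<Sum>i\<in>{1..n}. lam i * r i) + ?E w / (2 * \<mu>))
        + t * (1 - t) / 2 * (norm d)\<^sup>2 * (?X + (?Y - 1) / \<mu>)"
      using assms(1) by (simp add: add_divide_distrib distrib_left)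
    also have "?X + (?Y - 1) / \<mu> = 1 / (inverse S - \<mu>)"
      using optimal_split_constant[of \<mu> "{1..n}" \<epsilon>s lam S, OF assms(1) eps lam_sum S(1,2)] \<kappa>
      unfolding c_def \<kappa>_def by simp
    also have "((\<Sum>i\<in>{1..n}. lam i * r i) + ?E w / (2 * \<mu>))
        + t * (1 - t) / 2 * (norm d)\<^sup>2 * (1 / (inverse S - \<mu>))
        \<le> b + t * (1 - t) * (1 / (2 * (inverse S - \<mu>))) * (norm (x - y))\<^sup>2"
    proof -
      have "t * (1 - t) / 2 * (norm d)\<^sup>2 * (1 / (inverse S - \<mu>))
          = t * (1 - t) * (1 / (2 * (inverse S - \<mu>))) * (norm (x - y))\<^sup>2"
        by (simp only: d_def times_divide_eq_left times_divide_eq_right divide_divide_eq_left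
            mult_1 mult_1_right)
      then show ?thesis
        using wb by linarith
    qed
    finally show ?thesis .
  qed
  finally show ?thesis
    by simp
qed

theorem theorem3p24:
  fixes \<mu> :: real and n :: nat
    and f :: "nat \<Rightarrow> 'a::{real_inner, complete_space} \<Rightarrow> ereal"
    and lam \<epsilon>s :: "nat \<Rightarrow> real" and \<epsilon> :: real
  assumes "\<mu> > 0"
    and "n \<ge> 1"
    and "\<And>i. i \<in> {1..n} \<Longrightarrow> lam i > 0"
    and "(\<Sum>i\<in>{1..n}. lam i) = 1"
    and "\<And>i. i \<in> {1..n} \<Longrightarrow> \<epsilon>s i \<ge> 0"
    and "\<And>i. i \<in> {1..n} \<Longrightarrow> proper_fun (f i)"
    and "\<And>i. i \<in> {1..n} \<Longrightarrow> lsc_fun (f i)"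
    and "\<And>i. i \<in> {1..n} \<Longrightarrow> smooth_fun (\<epsilon>s i) (f i)"
    and "\<epsilon> = inverse (\<Sum>i\<in>{1..n}. lam i * inverse (\<epsilon>s i + \<mu>)) - \<mu>"
  shows "smooth_fun \<epsilon> (proximal_average \<mu> n f lam) \<and>
    ((\<exists>i0\<in>{1..n}. strongly_smooth_fun (\<epsilon>s i0) (f i0))
       \<longrightarrow> strongly_smooth_fun \<epsilon> (proximal_average \<mu> n f lam))"
proof -
  let ?p = "proximal_average \<mu> n f lam"
  have conv: "\<And>i. i \<in> {1..n} \<Longrightarrow> convex_fun (f i)"
    using assms(8) by (simp add: smooth_fun_def)
  define S where "S = (\<Sum>i\<in>{1..n}. lam i * inverse (\<epsilon>s i + \<mu>))"
  define \<kappa> where "\<kappa> = (\<Sum>i\<in>{1..n}. lam i * (\<epsilon>s i / (\<epsilon>s i + \<mu>)))"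
  have \<epsilon>: "\<epsilon> = inverse S - \<mu>"
    unfolding S_def assms(9) ..
  have pos: "\<epsilon>s i + \<mu> > 0" if "i \<in> {1..n}" for i
    using assms(5)[OF that] assms(1) by linarith
  have S: "S > 0"
    unfolding S_def using assms(2) assms(3) pos by (intro sum_pos) auto
  have "\<kappa> = 1 - \<mu> * S"
    unfolding \<kappa>_def S_def using sum_weights_complement[OF assms(1,5,4)] .
  then have \<epsilon>_\<kappa>: "\<epsilon> = \<kappa> / S"
    using S by (simp add: \<epsilon> field_simps)
  have terms: "0 \<le> lam i * (\<epsilon>s i / (\<epsilon>s i + \<mu>))" if "i \<in> {1..n}" for i
    using assms(3)[OF that] assms(5)[OF that] pos[OF that] by simp
  have \<epsilon>_nonneg: "\<epsilon> \<ge> 0"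
    unfolding \<epsilon>_\<kappa> \<kappa>_def using S terms by (intro divide_nonneg_pos sum_nonneg) auto
  have \<epsilon>_pos: "\<epsilon> > 0" if "i \<in> {1..n}" "\<epsilon>s i > 0" for i
    unfolding \<epsilon>_\<kappa> \<kappa>_def
    using S terms that assms(3)[OF that(1)] pos[OF that(1)]
    by (intro divide_pos_pos sum_pos2[of _ i]) auto
  have ineq: "ereal (1 - t) * ?p x + ereal t * ?p y
      \<le> ?p ((1 - t) *\<^sub>R x + t *\<^sub>R y) + ereal (t * (1 - t) * (1 / (2 * \<epsilon>)) * (norm (x - y))\<^sup>2)"
    if "\<epsilon> > 0" and t: "t \<in> {0<..<1}" and fin: "?p ((1 - t) *\<^sub>R x + t *\<^sub>R y) < \<infinity>" for x y t
  proof -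
    have "?p ((1 - t) *\<^sub>R x + t *\<^sub>R y) \<noteq> -\<infinity>"
      using proper_proximal_average[of \<mu> n lam f, OF assms(1,3,6,7) conv] by (simp add: proper_fun_def)
    with fin obtain b where b: "?p ((1 - t) *\<^sub>R x + t *\<^sub>R y) = ereal b"
      by (cases "?p ((1 - t) *\<^sub>R x + t *\<^sub>R y)") auto
    show ?thesis
      unfolding b
    proof (rule ereal_le_epsilon2)
      fix e :: real assume "e > 0"
      then have "?p ((1 - t) *\<^sub>R x + t *\<^sub>R y) < ereal (b + e)"
        by (simp add: b)
      from smooth_inequality_proximal_average[of \<mu> n lam \<epsilon>s f, OF assms(1,3,4,5,8) S_def S _ _ _ this]
      show "ereal (1 - t) * ?p x + ereal t * ?p y
          \<le> ereal b + ereal (t * (1 - t) * (1 / (2 * \<epsilon>)) * (norm (x - y))\<^sup>2) + ereal e"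
        using that(1) t unfolding \<epsilon> by (simp add: algebra_simps)
    qed
  qed
  have "proper_fun ?p"
    by (rule proper_proximal_average[OF assms(1,3,6,7) conv])
  moreover have "convex_fun ?p"
    by (rule convex_proximal_average[OF assms(1,3,4,6,7) conv])
  ultimately have "smooth_fun \<epsilon> ?p"
    unfolding smooth_fun_def using \<epsilon>_nonneg ineq by simp
  then show ?thesis
    using \<epsilon>_pos by (auto simp: strongly_smooth_fun_def)
qed

end
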